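(* Let $\mathcal H$ be a finite graph and $\Delta$ a positive integer. The following are equivalent: (1) $\mathcal H$ admits a proper vertex coloring with $\Delta$ colors; (2) for every $r$, there exists a $0$-round GLOCAL algorithm that $\Delta$-colors $\mathrm{Hom}(T^r_\Delta,\mathcal H)$; (3) there exist $r$ and an $r$-round GLOCAL algorithm that $\Delta$-colors $\mathrm{Hom}(T^{r+1}_\Delta,\mathcal H)$.
   Context: Let $T_\Delta$ be the infinite $\Delta$-regular tree and $T^r_\Delta$ the ball of radius $r$ around a vertex of $T_\Delta$. $\mathrm{Hom}(T^r_\Delta,\mathcal H)$ is the collection of labeled trees obtained by labeling the vertices of $T^r_\Delta$ with vertices of $\mathcal H$ such that the labeling is a graph homomorphism $T^r_\Delta\to\mathcal H$. An $r$-round GLOCAL algorithm (on trees with degrees $\le\Delta$) is a partial function from isomorphism classes of labeled rooted trees of maximum degree $\le\Delta$ and radius $\le r$ (from the root) to a set $\Sigma$; running it on a labeled tree $G$ assigns to each vertex $v$ its value on the labeled ball $B_G(v,r)$ rooted at $v$. It $\Delta$-colors a collection $\mathcal F$ of labeled trees if for every $G\in\mathcal F$ running it on $G$ assigns every vertex one of $\Delta$ colors and the result is a proper vertex coloring of $G$. *)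

theory Defs
  imports "Graph_Theory.Graph_Theory"
begin

text \<open>Graphs are symmetric loopfree pair digraphs: an edge \<open>uv\<close> is the pair of arcs \<open>(u,v)\<close>, \<open>(v,u)\<close>.\<close>

definition proper_coloring :: "'a pair_pre_digraph \<Rightarrow> nat \<Rightarrow> ('a \<Rightarrow> nat) \<Rightarrow> bool" where
  "proper_coloring G k c \<longleftrightarrow>
     (\<forall>v \<in> pverts G. c v < k) \<and> (\<forall>(u, v) \<in> parcs G. c u \<noteq> c v)"

definition graph_hom :: "'a pair_pre_digraph \<Rightarrow> 'b pair_pre_digraph \<Rightarrow> ('a \<Rightarrow> 'b) \<Rightarrow> bool" where
  "graph_hom G H f \<longleftrightarrow>
     (\<forall>v \<in> pverts G. f v \<in> pverts H) \<and> (\<forall>(u, v) \<in> parcs G. (f u, f v) \<in> parcs H)"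

text \<open>The library predicate \<open>tree\<close> also forbids the closed walk \<open>u, v, u\<close>, so no symmetric
  digraph with an edge satisfies it. For undirected graphs only cycles of length at least 3 count.\<close>

definition undirected_tree :: "'a pair_pre_digraph \<Rightarrow> bool" where
  "undirected_tree G \<longleftrightarrow>
     pair_bidirected_digraph G \<and> Digraph_Component.connected (with_proj G) \<and>
     \<not> (\<exists>p. pre_digraph.cycle (with_proj G) p \<and> 3 \<le> length p)"

definition ball_verts :: "'a pair_pre_digraph \<Rightarrow> 'a \<Rightarrow> nat \<Rightarrow> 'a set" where
  "ball_verts G v r = {u. \<exists>p. pre_digraph.awalk (with_proj G) v p u \<and> length p \<le> r}"

definition graph_ball :: "'a pair_pre_digraph \<Rightarrow> 'a \<Rightarrow> nat \<Rightarrow> 'a pair_pre_digraph" where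
  "graph_ball G v r = \<lparr> pverts = ball_verts G v r, parcs = Restr (parcs G) (ball_verts G v r) \<rparr>"

text \<open>\<open>T\<^sub>\<Delta>\<close>: a vertex is the list of child indices leading to it from the vertex \<open>[]\<close>, which has
  \<open>\<Delta>\<close> children, whereas every other vertex has \<open>\<Delta> - 1\<close> children. For \<open>\<Delta> = 1\<close> this is a single edge.\<close>

definition regular_tree_verts :: "nat \<Rightarrow> nat list set" where
  "regular_tree_verts \<Delta> =
     {xs. \<forall>i < length xs. xs ! i < (if i = 0 then \<Delta> else \<Delta> - 1)}"

definition regular_tree :: "nat \<Rightarrow> nat list pair_pre_digraph" where
  "regular_tree \<Delta> =
     \<lparr> pverts = regular_tree_verts \<Delta>,
       parcs = {(xs, ys). xs \<in> regular_tree_verts \<Delta> \<and> ys \<in> regular_tree_verts \<Delta> \<and>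
                  (\<exists>i. ys = xs @ [i] \<or> xs = ys @ [i])} \<rparr>"

lemma regular_tree_verts_Nil: "[] \<in> regular_tree_verts \<Delta>"
  by (simp add: regular_tree_verts_def)

lemma regular_tree_verts_snoc:
  "xs @ [i] \<in> regular_tree_verts \<Delta> \<longleftrightarrow>
     xs \<in> regular_tree_verts \<Delta> \<and> i < (if xs = [] then \<Delta> else \<Delta> - 1)"
  by (auto simp: regular_tree_verts_def nth_append less_Suc_eq split: if_splits)

lemma pverts_regular_tree [simp]: "pverts (regular_tree \<Delta>) = regular_tree_verts \<Delta>"
  by (simp add: regular_tree_def)

lemma regular_tree_arcs_nbrs:
  "(xs, ys) \<in> parcs (regular_tree \<Delta>) \<Longrightarrow> length ys \<le> length xs \<Longrightarrow> ys = butlast xs"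
  by (auto simp: regular_tree_def)

lemma regular_tree_bidirected: "pair_bidirected_digraph (regular_tree \<Delta>)"
  by unfold_locales
     (auto simp: regular_tree_def symmetric_def sym_def)

lemma regular_tree_no_cycle:
  assumes "pre_digraph.cycle (with_proj (regular_tree \<Delta>)) p" "3 \<le> length p"
  shows False
proof -
  interpret pair_bidirected_digraph "regular_tree \<Delta>" by (rule regular_tree_bidirected)
  obtain u where w: "awalk u p u" and d: "distinct (tl (awalk_verts u p))" and "p \<noteq> []"
    using assms(1) by (auto simp: cycle_def)
  let ?n = "length p"
  define x where "x i = snd (p ! (i mod ?n))" for i
  have *: "pcas u q v \<Longrightarrow> pawalk_verts u q = u # map snd q" for u v and q :: "(nat list \<times> nat list) list"
    by (induction q arbitrary: u) auto
  have ds: "distinct (map snd p)"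
    using *[of u p u] w d by (auto simp: awalk_def)
  have last: "pcas u q v \<Longrightarrow> q \<noteq> [] \<Longrightarrow> fst (hd q) = u \<and> snd (last q) = v" for u v and q :: "(nat list \<times> nat list) list"
    by (induction q arbitrary: u) (auto split: if_splits)
  have step: "pcas u q v \<Longrightarrow> Suc i < length q \<Longrightarrow> fst (q ! Suc i) = snd (q ! i)" for u v i and q :: "(nat list \<times> nat list) list"
  proof (induction q arbitrary: u i)
    case (Cons e q)
    then show ?case by (cases i; cases q) auto
  qed simp
  have arc: "(x i, x (Suc i)) \<in> parcs (regular_tree \<Delta>)" for i
  proof -
    have "fst (p ! (Suc i mod ?n)) = x i"
    proof (cases "Suc (i mod ?n) = ?n")
      case True
      then have "Suc i mod ?n = 0" "i mod ?n = ?n - 1" by (auto simp: mod_Suc)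
      then show ?thesis using last[of u p u] w \<open>p \<noteq> []\<close>
        by (auto simp: awalk_def x_def hd_conv_nth last_conv_nth)
    next
      case False
      then have "Suc i mod ?n = Suc (i mod ?n)" by (auto simp: mod_Suc)
      moreover have "Suc (i mod ?n) < ?n" using False \<open>p \<noteq> []\<close>
        by (metis Suc_lessI length_greater_0_conv mod_less_divisor)
      ultimately show ?thesis using step[of u p u "i mod ?n"] w by (auto simp: awalk_def x_def)
    qed
    moreover have "p ! (Suc i mod ?n) \<in> parcs (regular_tree \<Delta>)"
      using w \<open>p \<noteq> []\<close> by (auto simp: awalk_def intro!: subsetD[OF _ nth_mem])
    ultimately show ?thesis by (metis x_def prod.collapse)
  qed
  obtain m where m: "m < ?n" and mx: "\<And>i. i < ?n \<Longrightarrow> length (x i) \<le> length (x m)"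
  proof -
    have "finite ((\<lambda>i. length (x i)) ` {..<?n})" "(\<lambda>i. length (x i)) ` {..<?n} \<noteq> {}"
      using \<open>p \<noteq> []\<close> by auto
    from Max_in[OF this] Max_ge[OF this(1)] show ?thesis using that by fastforce
  qed
  have mx': "length (x i) \<le> length (x m)" for i
    using mx[of "i mod ?n"] \<open>p \<noteq> []\<close> by (simp add: x_def)
  have xm: "x (Suc (m + ?n - 1)) = x m" using \<open>p \<noteq> []\<close> by (simp add: x_def)
  have "x (Suc m) = butlast (x m)"
    using regular_tree_arcs_nbrs[OF arc mx'] .
  moreover have "x (m + ?n - 1) = butlast (x m)"
    using regular_tree_arcs_nbrs[of "x m" "x (m + ?n - 1)"] arc[of "m + ?n - 1"] xm mx'
      arcs_symmetric by auto
  ultimately have "map snd p ! (Suc m mod ?n) = map snd p ! ((m + ?n - 1) mod ?n)"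
    using \<open>p \<noteq> []\<close> by (simp add: x_def)
  then have eq: "Suc m mod ?n = (m + ?n - 1) mod ?n"
    using ds \<open>p \<noteq> []\<close> by (subst (asm) nth_eq_iff_index_eq) auto
  show False
  proof (cases m)
    case 0
    then show ?thesis using eq assms(2) by simp
  next
    case (Suc k)
    then have "(m + ?n - 1) mod ?n = k" using m by simp
    then show ?thesis using eq m Suc assms(2) by (auto simp: mod_Suc split: if_splits)
  qed
qed

lemma regular_tree_connected: "Digraph_Component.connected (with_proj (regular_tree \<Delta>))"
proof -
  interpret pair_bidirected_digraph "regular_tree \<Delta>" by (rule regular_tree_bidirected)
  have root: "[] \<rightarrow>\<^sup>*\<^bsub>with_proj (regular_tree \<Delta>)\<^esub> xs" if "xs \<in> regular_tree_verts \<Delta>" for xs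
    using that
  proof (induction xs rule: rev_induct)
    case Nil
    then show ?case using regular_tree_verts_Nil by (intro reachable_refl) simp
  next
    case (snoc i xs)
    then have "xs \<in> regular_tree_verts \<Delta>" by (simp add: regular_tree_verts_snoc)
    then have "(xs, xs @ [i]) \<in> parcs (regular_tree \<Delta>)"
      using snoc by (auto simp: regular_tree_def)
    with snoc.IH[OF \<open>xs \<in> _\<close>] show ?case by (auto intro: reachable_adj_trans)
  qed
  have "xs \<rightarrow>\<^sup>*\<^bsub>with_proj (regular_tree \<Delta>)\<^esub> ys"
    if "xs \<in> regular_tree_verts \<Delta>" "ys \<in> regular_tree_verts \<Delta>" for xs ys
    using symmetric_reachable[OF pair_sym_arcs root[OF that(1)]] root[OF that(2)]
    by (rule reachable_trans)
  then have "strongly_connected (with_proj (regular_tree \<Delta>))"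
    using regular_tree_verts_Nil[of \<Delta>] by (intro strongly_connectedI) auto
  moreover have "mk_symmetric (with_proj (regular_tree \<Delta>)) = regular_tree \<Delta>"
    by (auto simp: mk_symmetric_def regular_tree_def)
  ultimately show ?thesis by (simp add: Digraph_Component.connected_def)
qed

lemma undirected_tree_regular_tree: "undirected_tree (regular_tree \<Delta>)"
  using regular_tree_bidirected regular_tree_connected regular_tree_no_cycle
  by (auto simp: undirected_tree_def)

lemma out_degree_regular_tree:
  assumes "xs \<in> pverts (regular_tree \<Delta>)" "\<Delta> > 0"
  shows "out_degree (with_proj (regular_tree \<Delta>)) xs = \<Delta>"
proof -
  have xs: "xs \<in> regular_tree_verts \<Delta>" using assms by (simp add: regular_tree_def)
  let ?C = "(\<lambda>i. (xs, xs @ [i])) ` {..<(if xs = [] then \<Delta> else \<Delta> - 1)}"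
  let ?P = "if xs = [] then {} else {(xs, butlast xs)}"
  have bl: "butlast xs \<in> regular_tree_verts \<Delta>"
    using xs by (cases xs rule: rev_cases) (auto simp: regular_tree_verts_snoc)
  have "out_arcs (with_proj (regular_tree \<Delta>)) xs = ?C \<union> ?P"
    using xs bl regular_tree_verts_snoc[of "[]"] regular_tree_verts_snoc[of xs]
    by (cases xs rule: rev_cases) (auto simp: out_arcs_def regular_tree_def)
  moreover have "card ?C = (if xs = [] then \<Delta> else \<Delta> - 1)"
    by (subst card_image) (auto simp: inj_on_def)
  moreover have "?C \<inter> ?P = {}" by (auto dest: arg_cong[where f = length])
  ultimately show ?thesis using assms(2) by (auto simp: out_degree_def card_Un_disjoint)
qed

record ('v, 'l) labeled_graph =
  skel :: "'v pair_pre_digraph"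
  lab :: "'v \<Rightarrow> 'l"

record ('v, 'l) rooted_labeled_graph = "('v, 'l) labeled_graph" +
  root :: 'v

definition Hom_ball :: "nat \<Rightarrow> nat \<Rightarrow> 'h pair_pre_digraph \<Rightarrow> (nat list, 'h) labeled_graph set" where
  "Hom_ball \<Delta> r H =
     {\<lparr> skel = graph_ball (regular_tree \<Delta>) [] r, lab = f \<rparr> | f.
        graph_hom (graph_ball (regular_tree \<Delta>) [] r) H f}"

definition rooted_labeled_trees :: "nat \<Rightarrow> nat \<Rightarrow> ('v, 'l) rooted_labeled_graph set" where
  "rooted_labeled_trees \<Delta> r =
     {T. pair_graph (skel T) \<and> undirected_tree (skel T) \<and> root T \<in> pverts (skel T) \<and>
         (\<forall>v \<in> pverts (skel T). out_degree (with_proj (skel T)) v \<le> \<Delta>) \<and>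
         pverts (skel T) \<subseteq> ball_verts (skel T) (root T) r}"

text \<open>Labels outside the vertex set are irrelevant.\<close>

definition rooted_labeled_iso :: "('v, 'l) rooted_labeled_graph rel" where
  "rooted_labeled_iso =
     {(S, T). \<exists>f. bij_betw f (pverts (skel S)) (pverts (skel T)) \<and>
                  parcs (skel T) = map_prod f f ` parcs (skel S) \<and>
                  f (root S) = root T \<and>
                  (\<forall>v \<in> pverts (skel S). lab T (f v) = lab S v)}"

text \<open>Isomorphism classes are taken among trees with vertices in the type \<open>'v\<close>. For infinite \<open>'v\<close>
  (below: \<open>nat list\<close>) every finite rooted labeled tree is isomorphic to one of these.\<close>

type_synonym ('v, 'l, 's) glocal = "('v, 'l) rooted_labeled_graph set \<rightharpoonup> 's"

definition glocal_algorithm :: "nat \<Rightarrow> nat \<Rightarrow> ('v, 'l, 's) glocal \<Rightarrow> bool" where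
  "glocal_algorithm \<Delta> r A \<longleftrightarrow> dom A \<subseteq> rooted_labeled_trees \<Delta> r // rooted_labeled_iso"

definition rooted_ball ::
    "('v, 'l) labeled_graph \<Rightarrow> 'v \<Rightarrow> nat \<Rightarrow> ('v, 'l) rooted_labeled_graph" where
  "rooted_ball G v r = \<lparr> skel = graph_ball (skel G) v r, lab = lab G, root = v \<rparr>"

definition run_glocal ::
    "nat \<Rightarrow> ('v, 'l, 's) glocal \<Rightarrow> ('v, 'l) labeled_graph \<Rightarrow> 'v \<Rightarrow> 's option" where
  "run_glocal r A G v = A (rooted_labeled_iso `` {rooted_ball G v r})"

definition glocal_colors ::
    "nat \<Rightarrow> nat \<Rightarrow> ('v, 'l, nat) glocal \<Rightarrow> ('v, 'l) labeled_graph set \<Rightarrow> bool" where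
  "glocal_colors \<Delta> r A \<F> \<longleftrightarrow>
     (\<forall>G \<in> \<F>. \<exists>c. proper_coloring (skel G) \<Delta> c \<and>
                  (\<forall>v \<in> pverts (skel G). run_glocal r A G v = Some (c v)))"

end

theory Submission
  imports Defs
begin

text \<open>For the implication from (3) to (1), a finite version of Marks' determinacy argument is used. For
  a label \<open>h\<close> and a colour \<open>i\<close>, Alice and Bob label \<open>T\<^sup>r\<^sub>\<Delta>\<close> level by level, starting from \<open>h\<close> at the root;
  Alice owns the \<open>i\<close>-th branch, Bob everything else, and Bob wins if the algorithm gives the root
  colour \<open>i\<close>. If Bob lost for every \<open>i\<close>, Alice's moves in all \<open>\<Delta>\<close> games could be glued to one labelling
  whose root gets no colour. So some \<open>c h\<close> is a winning colour for Bob. If \<open>h\<close> and \<open>h'\<close> were adjacent with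
  \<open>c h = c h' = i\<close>, then the two games could be played against each other across the \<open>i\<close>-th edge at
  the root, Bob's part of each tree being Alice's part of the other, and both ends of that edge
  would be coloured \<open>i\<close>. The labels are fixed one level at a time, so no strategies are needed.\<close>

section \<open>The automorphism exchanging the ends of an edge at the root\<close>

lemma regular_tree_verts_Cons:
  "j # ys \<in> regular_tree_verts \<Delta> \<longleftrightarrow> j < \<Delta> \<and> (\<forall>y \<in> set ys. y < \<Delta> - 1)"
  by (auto simp: regular_tree_verts_def All_less_Suc2 all_set_conv_all_nth)

lemma in_parcs_regular_tree:
  "(xs, ys) \<in> parcs (regular_tree \<Delta>) \<longleftrightarrow>
     xs \<in> regular_tree_verts \<Delta> \<and> ys \<in> regular_tree_verts \<Delta> \<and> (\<exists>i. ys = xs @ [i] \<or> xs = ys @ [i])"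
  by (simp add: regular_tree_def)

text \<open>The automorphism exchanging \<open>[]\<close> and \<open>[i]\<close>. Child indices are shifted because \<open>[i]\<close>, unlike
  \<open>[]\<close>, has no child of index \<open>\<Delta> - 1\<close>: its other neighbours correspond to the \<open>j \<noteq> i\<close>.\<close>

fun flip_edge :: "nat \<Rightarrow> nat list \<Rightarrow> nat list" where
  "flip_edge i [] = [i]"
| "flip_edge i (j # ys) =
     (if j = i then (case ys of [] \<Rightarrow> [] | k # zs \<Rightarrow> (if k < i then k else Suc k) # zs)
      else i # (if j < i then j else j - 1) # ys)"

text \<open>The distance to the nearer end of the edge between \<open>[]\<close> and \<open>[i]\<close>.\<close>

definition side_depth :: "nat \<Rightarrow> nat list \<Rightarrow> nat" where
  "side_depth i xs = (if xs \<noteq> [] \<and> hd xs = i then length xs - 1 else length xs)"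

lemma flip_edge_flip_edge [simp]: "flip_edge i (flip_edge i xs) = xs"
  by (cases xs) (auto split: list.splits)

lemma flip_edge_in_verts:
  "i < \<Delta> \<Longrightarrow> xs \<in> regular_tree_verts \<Delta> \<Longrightarrow> flip_edge i xs \<in> regular_tree_verts \<Delta>"
  by (cases xs) (auto simp: regular_tree_verts_Cons regular_tree_verts_Nil split: list.splits)

text \<open>Only the edge between \<open>[]\<close> and \<open>[i]\<close> has its parent and child
  swapped; any other child goes to a child of the image of its parent.\<close>

lemma flip_edge_snoc:
  assumes "xs \<noteq> [] \<or> j \<noteq> i"
  obtains j' where "flip_edge i (xs @ [j]) = flip_edge i xs @ [j']"
proof (cases xs)
  case Nil
  with assms show ?thesis by (intro that) auto
next
  case (Cons a ys)
  with assms show ?thesis by (cases ys; cases "a = i") (auto intro: that)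
qed

lemma side_depth_flip_edge [simp]: "side_depth i (flip_edge i xs) = side_depth i xs"
  by (cases xs) (auto simp: side_depth_def split: list.splits)

lemma hd_flip_edge: "xs \<noteq> [] \<Longrightarrow> hd xs \<noteq> i \<Longrightarrow> hd (flip_edge i xs) = i"
  by (cases xs) auto

lemma hd_flip_edge_neq: "xs \<noteq> [] \<Longrightarrow> hd xs = i \<Longrightarrow> flip_edge i xs = [] \<or> hd (flip_edge i xs) \<noteq> i"
  by (cases xs) (auto split: list.splits)

lemma side_depth_snoc:
  "xs \<noteq> [] \<or> j \<noteq> i \<Longrightarrow> side_depth i (xs @ [j]) = Suc (side_depth i xs)"
  by (cases xs) (auto simp: side_depth_def)

lemma side_depth_le_length: "side_depth i xs \<le> length xs"
  by (simp add: side_depth_def)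

lemma flip_edge_arc:
  assumes "i < \<Delta>" "(xs, ys) \<in> parcs (regular_tree \<Delta>)"
  shows "(flip_edge i xs, flip_edge i ys) \<in> parcs (regular_tree \<Delta>)"
proof -
  have *: "\<exists>k. flip_edge i (zs @ [j]) = flip_edge i zs @ [k] \<or> flip_edge i zs = flip_edge i (zs @ [j]) @ [k]"
    for zs j
    by (cases "zs \<noteq> [] \<or> j \<noteq> i") (metis flip_edge_snoc, auto)
  from assms show ?thesis using * by (fastforce simp: in_parcs_regular_tree flip_edge_in_verts)
qed

section \<open>The labelling game\<close>

definition tree_hom_upto :: "nat \<Rightarrow> 'h rel \<Rightarrow> nat \<Rightarrow> (nat list \<Rightarrow> 'h) \<Rightarrow> bool" where
  "tree_hom_upto \<Delta> E n f \<longleftrightarrow>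
     (\<forall>xs j. xs @ [j] \<in> regular_tree_verts \<Delta> \<longrightarrow> length xs < n \<longrightarrow> (f xs, f (xs @ [j])) \<in> E)"

text \<open>\<open>col f\<close> stands for the output at the root under the labelling
  \<open>f\<close>. Since \<open>flip_edge i\<close> moves \<open>[i]\<close> to the root,
  \<open>col (f \<circ> flip_edge i)\<close> is the output at \<open>[i]\<close>. The assumptions on
  \<open>col\<close> are thus locality, totality and properness on the edge from \<open>[]\<close>
  to \<open>[i]\<close>.\<close>

locale root_coloring =
  fixes \<Delta> r :: nat and E :: "'h rel" and col :: "(nat list \<Rightarrow> 'h) \<Rightarrow> nat option"
  assumes sym_E: "sym E"
    and col_cong: "(\<And>xs. xs \<in> regular_tree_verts \<Delta> \<Longrightarrow> length xs \<le> r \<Longrightarrow> f xs = g xs) \<Longrightarrow> col f = col g"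
    and col_total: "tree_hom_upto \<Delta> E (Suc r) f \<Longrightarrow> \<exists>c < \<Delta>. col f = Some c"
    and col_flip: "i < \<Delta> \<Longrightarrow> tree_hom_upto \<Delta> E (Suc r) f \<Longrightarrow> col f \<noteq> col (f \<circ> flip_edge i)"
begin

abbreviation "V \<equiv> regular_tree_verts \<Delta>"

text \<open>Position with \<open>m\<close> rounds left, the levels up to \<open>r - m\<close> being labelled. In each round Alice
  labels the next level below the vertex \<open>[i]\<close>, then Bob labels the rest of that level; Bob wants
  the root to be coloured \<open>i\<close>.\<close>

primrec bob_wins :: "nat \<Rightarrow> nat \<Rightarrow> (nat list \<Rightarrow> 'h) \<Rightarrow> bool" where
  "bob_wins i 0 f \<longleftrightarrow> col f = Some i"
| "bob_wins i (Suc m) f \<longleftrightarrow>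
     (\<forall>x. (\<forall>xs \<in> V. length xs = r - m \<and> hd xs = i \<longrightarrow> (f (butlast xs), x xs) \<in> E) \<longrightarrow>
       (\<exists>y. (\<forall>xs \<in> V. length xs = r - m \<and> hd xs \<noteq> i \<longrightarrow> (f (butlast xs), y xs) \<in> E) \<and>
         bob_wins i m (\<lambda>xs. if length xs = r - m then if hd xs = i then x xs else y xs else f xs)))"

lemma butlast_in_verts: "xs \<in> V \<Longrightarrow> butlast xs \<in> V"
  by (cases xs rule: rev_cases) (auto simp: regular_tree_verts_snoc)

text \<open>Positions are total functions, but the remaining rounds overwrite all levels above
  \<open>r - m\<close> up to \<open>r\<close>, and \<open>col\<close> reads nothing beyond.\<close>

lemma bob_wins_cong:
  assumes "\<And>xs. xs \<in> V \<Longrightarrow> length xs \<le> r - m \<Longrightarrow> f xs = g xs" "m \<le> r"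
  shows "bob_wins i m f \<longleftrightarrow> bob_wins i m g"
  using assms
proof (induction m arbitrary: f g)
  case 0
  then show ?case using col_cong[of f g] by simp
next
  case (Suc m)
  have b: "f (butlast xs) = g (butlast xs)" if "xs \<in> V" "length xs = r - m" for xs
    using that Suc.prems by (intro Suc.prems(1)) (auto simp: butlast_in_verts)
  have c: "bob_wins i m (\<lambda>xs. if length xs = r - m then if hd xs = i then x xs else y xs else f xs) \<longleftrightarrow>
     bob_wins i m (\<lambda>xs. if length xs = r - m then if hd xs = i then x xs else y xs else g xs)" for x y
    by (rule Suc.IH) (use Suc.prems in auto)
  show ?case unfolding bob_wins.simps c using b by (auto cong: conj_cong imp_cong)
qed

lemma ex_bob_wins:
  assumes "(h, h') \<in> E"
  shows "\<exists>i < \<Delta>. bob_wins i r (\<lambda>_. h)"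
proof (rule ccontr)
  assume "\<not> ?thesis"
  then have lose: "\<not> bob_wins i r (\<lambda>_. h)" if "i < \<Delta>" for i using that by blast
  \<comment> \<open>Invariant: one labelling of the first \<open>k\<close> levels is lost for Bob in
    all \<Delta> games at once.\<close>
  have "\<exists>f. f [] = h \<and> tree_hom_upto \<Delta> E k f \<and> (\<forall>i < \<Delta>. \<not> bob_wins i (r - k) f)" if "k \<le> r" for k
    using that
  proof (induction k)
    case 0
    then show ?case using lose by (intro exI[of _ "\<lambda>_. h"]) (simp add: tree_hom_upto_def)
  next
    case (Suc k)
    then obtain f where f: "f [] = h" "tree_hom_upto \<Delta> E k f" "\<And>i. i < \<Delta> \<Longrightarrow> \<not> bob_wins i (r - k) f"
      by auto
    define m where "m = r - Suc k"
    have m: "r - k = Suc m" "r - m = Suc k" using Suc.prems by (auto simp: m_def)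
    \<comment> \<open>The negation of a win for Bob: a legal move that defeats every reply. It is
      named so that choice can fix such a move for all \<open>i\<close> before they are
      glued.\<close>
    define alice where "alice i x \<longleftrightarrow>
       (\<forall>xs \<in> V. length xs = Suc k \<and> hd xs = i \<longrightarrow> (f (butlast xs), x xs) \<in> E) \<and>
       (\<forall>y. (\<forall>xs \<in> V. length xs = Suc k \<and> hd xs \<noteq> i \<longrightarrow> (f (butlast xs), y xs) \<in> E) \<longrightarrow>
         \<not> bob_wins i m (\<lambda>xs. if length xs = Suc k then if hd xs = i then x xs else y xs else f xs))" for i x
    have "\<exists>x. alice i x" if "i < \<Delta>" for i
      using f(3)[OF that] unfolding m(1) bob_wins.simps m(2) alice_def by blast
    then have "\<forall>i. \<exists>x. i < \<Delta> \<longrightarrow> alice i x" by blast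
    from choice[OF this] obtain x where "\<And>i. i < \<Delta> \<Longrightarrow> alice i (x i)" by blast
    then have
      x1: "\<And>i xs. i < \<Delta> \<Longrightarrow> xs \<in> V \<Longrightarrow> length xs = Suc k \<Longrightarrow> hd xs = i \<Longrightarrow> (f (butlast xs), x i xs) \<in> E" and
      x2: "\<And>i y. i < \<Delta> \<Longrightarrow> (\<forall>xs \<in> V. length xs = Suc k \<and> hd xs \<noteq> i \<longrightarrow> (f (butlast xs), y xs) \<in> E) \<Longrightarrow>
         \<not> bob_wins i m (\<lambda>xs. if length xs = Suc k then if hd xs = i then x i xs else y xs else f xs)"
      unfolding alice_def by blast+
    \<comment> \<open>A vertex of the new level is Alice's in exactly one game, that of its branch
      \<open>hd xs\<close>, and takes her label there. In game \<open>i\<close>, the labels from the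
      other games form a legal reply of Bob.\<close>
    define f' where "f' xs = (if length xs = Suc k then x (hd xs) xs else f xs)" for xs
    have x: "(f (butlast xs), x (hd xs) xs) \<in> E" if "xs \<in> V" "length xs = Suc k" for xs
      using that by (intro x1) (cases xs; auto simp: regular_tree_verts_Cons)+
    have "\<not> bob_wins i m f'" if "i < \<Delta>" for i
    proof -
      have "f' = (\<lambda>xs. if length xs = Suc k then if hd xs = i then x i xs else x (hd xs) xs else f xs)"
        by (auto simp: f'_def)
      then show ?thesis using x2[OF that, of "\<lambda>xs. x (hd xs) xs"] x by simp
    qed
    moreover have "tree_hom_upto \<Delta> E (Suc k) f'"
      unfolding tree_hom_upto_def
    proof (intro allI impI)
      fix xs j assume "xs @ [j] \<in> V" "length xs < Suc k"
      then show "(f' xs, f' (xs @ [j])) \<in> E"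
        using f(2) x[of "xs @ [j]"] by (auto simp: f'_def tree_hom_upto_def)
    qed
    moreover have "f' [] = h" using f(1) by (simp add: f'_def)
    ultimately show ?case unfolding m_def by blast
  qed
  from this[OF order_refl] obtain f where
    f: "f [] = h" "tree_hom_upto \<Delta> E r f" "\<And>i. i < \<Delta> \<Longrightarrow> col f \<noteq> Some i" by auto
  \<comment> \<open>\<open>col_total\<close> needs one level more than \<open>col\<close> reads, so
    every label must have a neighbour: the label of the parent, or \<open>h'\<close> at the
    root.\<close>
  have nonisol: "\<exists>z. (f xs, z) \<in> E" if "xs \<in> V" "length xs \<le> r" for xs
  proof (cases xs rule: rev_cases)
    case (snoc ys j)
    with that f(2) have "(f ys, f xs) \<in> E" by (simp add: tree_hom_upto_def)
    then show ?thesis using sym_E by (auto dest: symD)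
  qed (use f(1) assms in auto)
  define f' where "f' xs = (if length xs = Suc r then SOME z. (f (butlast xs), z) \<in> E else f xs)" for xs
  have "tree_hom_upto \<Delta> E (Suc r) f'"
    unfolding tree_hom_upto_def
  proof (intro allI impI)
    fix xs j assume *: "xs @ [j] \<in> V" "length xs < Suc r"
    then show "(f' xs, f' (xs @ [j])) \<in> E"
      using f(2) someI_ex[OF nonisol[of xs]]
      by (auto simp: f'_def tree_hom_upto_def regular_tree_verts_snoc)
  qed
  moreover have "col f' = col f" by (rule col_cong) (simp add: f'_def)
  ultimately show False using col_total f(3) by metis
qed

text \<open>The region within distance \<open>k\<close> of the edge from \<open>[]\<close> to
  \<open>[i]\<close> is invariant under \<open>flip_edge i\<close>. It contains the first
  \<open>k\<close> levels seen from either end and also branch \<open>i\<close> down to level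
  \<open>Suc k\<close>, which is Alice's next move.\<close>

definition region_hom :: "nat \<Rightarrow> nat \<Rightarrow> (nat list \<Rightarrow> 'h) \<Rightarrow> bool" where
  "region_hom i k g \<longleftrightarrow>
     (\<forall>(xs, ys) \<in> parcs (regular_tree \<Delta>). side_depth i xs \<le> k \<longrightarrow> side_depth i ys \<le> k \<longrightarrow> (g xs, g ys) \<in> E)"

lemma region_hom_flip_edge:
  assumes "i < \<Delta>" "region_hom i k g"
  shows "region_hom i k (g \<circ> flip_edge i)"
  using assms(2) flip_edge_arc[OF assms(1)] by (fastforce simp: region_hom_def)

lemma region_homI:
  assumes "\<And>xs j. xs @ [j] \<in> V \<Longrightarrow> side_depth i xs \<le> k \<Longrightarrow> side_depth i (xs @ [j]) \<le> k \<Longrightarrow>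
    (g xs, g (xs @ [j])) \<in> E"
  shows "region_hom i k g"
  using assms sym_E by (fastforce simp: region_hom_def in_parcs_regular_tree dest: symD)

lemma region_homD:
  assumes "region_hom i k g" "xs @ [j] \<in> V" "side_depth i xs \<le> k" "side_depth i (xs @ [j]) \<le> k"
  shows "(g xs, g (xs @ [j])) \<in> E"
  using assms by (fastforce simp: region_hom_def in_parcs_regular_tree regular_tree_verts_snoc)

text \<open>On branch \<open>i\<close>, level \<open>Suc k\<close> has side depth \<open>k\<close>,
  so Alice's next move is already part of \<open>g\<close> and is legal by
  \<open>region_hom\<close>. Only Bob's answer is new.\<close>

lemma bob_reply:
  assumes "bob_wins i (r - k) g" "region_hom i k g" "k < r"
  obtains y where
    "\<And>xs. xs \<in> V \<Longrightarrow> length xs = Suc k \<Longrightarrow> hd xs \<noteq> i \<Longrightarrow> (g (butlast xs), y xs) \<in> E"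
    "bob_wins i (r - Suc k) (\<lambda>xs. if length xs = Suc k \<and> hd xs \<noteq> i then y xs else g xs)"
proof -
  define m where "m = r - Suc k"
  have m: "r - k = Suc m" "r - m = Suc k" using assms by (auto simp: m_def)
  have "(g (butlast xs), g xs) \<in> E" if "xs \<in> V" "length xs = Suc k" "hd xs = i" for xs
  proof (cases xs rule: rev_cases)
    case (snoc zs j)
    with that show ?thesis
      using region_homD[OF assms(2), of zs j]
      by (cases zs) (auto simp: side_depth_def)
  qed (use that in simp)
  then obtain y where
    y: "\<forall>xs \<in> V. length xs = Suc k \<and> hd xs \<noteq> i \<longrightarrow> (g (butlast xs), y xs) \<in> E"
       "bob_wins i m (\<lambda>xs. if length xs = Suc k then if hd xs = i then g xs else y xs else g xs)"
    using assms(1) unfolding m(1) bob_wins.simps m(2) by blast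
  have "(\<lambda>xs. if length xs = Suc k then if hd xs = i then g xs else y xs else g xs) =
    (\<lambda>xs. if length xs = Suc k \<and> hd xs \<noteq> i then y xs else g xs)" by auto
  with y show ?thesis using that[of y] by (simp add: m_def)
qed

lemma adjacent_not_both_bob_wins:
  assumes "(h, h') \<in> E" "i < \<Delta>" "bob_wins i r (\<lambda>_. h)" "bob_wins i r (\<lambda>_. h')"
  shows False
proof -
  \<comment> \<open>Invariant: a single labelling is a won position for Bob both as seen from
    \<open>[]\<close> and as seen from \<open>[i]\<close>.\<close>
  have "\<exists>g. region_hom i k g \<and> bob_wins i (r - k) g \<and> bob_wins i (r - k) (g \<circ> flip_edge i)"
    if "k \<le> r" for k
    using that
  proof (induction k)
    case 0
    \<comment> \<open>At depth 0 the region is the edge itself; \<open>[i]\<close> is the root of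
      the second game.\<close>
    define g where "g xs = (if xs = [] then h else h')" for xs :: "nat list"
    have "bob_wins i r g \<longleftrightarrow> bob_wins i r (\<lambda>_. h)"
      "bob_wins i r (g \<circ> flip_edge i) \<longleftrightarrow> bob_wins i r (\<lambda>_. h')"
      by (rule bob_wins_cong; simp add: g_def)+
    moreover have "region_hom i 0 g"
      using assms(1)
      by (intro region_homI) (auto simp: g_def side_depth_def hd_append split: if_splits)
    ultimately show ?case unfolding diff_zero using assms(3,4) by blast
  next
    case (Suc k)
    then have k: "k < r" by simp
    obtain g where g: "region_hom i k g" "bob_wins i (r - k) g"
      "bob_wins i (r - k) (g \<circ> flip_edge i)" using Suc.IH[OF less_imp_le[OF k]] by blast
    obtain y where
      y: "\<And>xs. xs \<in> V \<Longrightarrow> length xs = Suc k \<Longrightarrow> hd xs \<noteq> i \<Longrightarrow> (g (butlast xs), y xs) \<in> E"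
      "bob_wins i (r - Suc k) (\<lambda>xs. if length xs = Suc k \<and> hd xs \<noteq> i then y xs else g xs)"
      by (rule bob_reply[OF g(2,1) k]) blast
    obtain y' where
      y': "\<And>xs. xs \<in> V \<Longrightarrow> length xs = Suc k \<Longrightarrow> hd xs \<noteq> i \<Longrightarrow> (g (flip_edge i (butlast xs)), y' xs) \<in> E"
      "bob_wins i (r - Suc k) (\<lambda>xs. if length xs = Suc k \<and> hd xs \<noteq> i then y' xs else g (flip_edge i xs))"
      by (rule bob_reply[OF g(3) region_hom_flip_edge[OF assms(2) g(1)] k, unfolded comp_apply]) blast
    \<comment> \<open>New vertices outside branch \<open>i\<close> take Bob's reply in the first
      game; those inside are carried by \<open>flip_edge i\<close> to where Bob replied in the
      second.\<close>
    define g' where "g' xs = (if side_depth i xs = Suc k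
      then if hd xs = i then y' (flip_edge i xs) else y xs else g xs)" for xs
    \<comment> \<open>Up to length \<open>Suc k\<close>, branch \<open>i\<close> has side depth at
      most \<open>k\<close>, so Alice's labels are still those of \<open>g\<close>.\<close>
    have "bob_wins i (r - Suc k) g'"
      by (rule iffD2[OF bob_wins_cong y(2)]) (use k in \<open>auto simp: g'_def side_depth_def split: if_splits\<close>)
    moreover have "bob_wins i (r - Suc k) (g' \<circ> flip_edge i)"
    proof (rule iffD2[OF bob_wins_cong y'(2)])
      fix xs :: "nat list" assume "length xs \<le> r - (r - Suc k)"
      then have len: "length xs \<le> Suc k" using k by simp
      show "(g' \<circ> flip_edge i) xs = (if length xs = Suc k \<and> hd xs \<noteq> i then y' xs else g (flip_edge i xs))"
      proof (cases "length xs = Suc k \<and> hd xs \<noteq> i")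
        case True
        then have "side_depth i xs = Suc k" "xs \<noteq> []" by (auto simp: side_depth_def)
        with True show ?thesis by (simp add: g'_def hd_flip_edge)
      next
        case False
        with len have "side_depth i xs \<noteq> Suc k" by (auto simp: side_depth_def)
        with False show ?thesis by (auto simp: g'_def)
      qed
    qed simp
    moreover have "region_hom i (Suc k) g'"
    proof (rule region_homI)
      fix xs j assume a: "xs @ [j] \<in> V" "side_depth i xs \<le> Suc k" "side_depth i (xs @ [j]) \<le> Suc k"
      show "(g' xs, g' (xs @ [j])) \<in> E"
      proof (cases "side_depth i (xs @ [j]) = Suc k")
        case False
        \<comment> \<open>A parent is never deeper than its child, so both ends belong to the old
          region.\<close>
        have "side_depth i xs \<le> side_depth i (xs @ [j])"
          by (cases "xs \<noteq> [] \<or> j \<noteq> i") (simp add: side_depth_snoc, simp add: side_depth_def)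
        with False a show ?thesis
          using region_homD[OF g(1), of xs j] by (simp add: g'_def)
      next
        case True
        then have ne: "xs \<noteq> [] \<or> j \<noteq> i" by (auto simp: side_depth_def)
        then have d: "side_depth i xs = k" using True by (simp add: side_depth_snoc)
        show ?thesis
        proof (cases "hd (xs @ [j]) = i")
          case False
          then have "length (xs @ [j]) = Suc k" using True by (simp add: side_depth_def)
          then show ?thesis using y(1)[OF a(1) _ False] True False d by (simp add: g'_def)
        next
          case hd: True
          \<comment> \<open>The arc is not the middle one, so \<open>flip_edge i\<close> keeps its
            direction and moves it out of branch \<open>i\<close>, where \<open>y'\<close> was
            legal.\<close>
          obtain j' where j': "flip_edge i (xs @ [j]) = flip_edge i xs @ [j']"
            using flip_edge_snoc[OF ne] .
          have 1: "hd (flip_edge i (xs @ [j])) \<noteq> i"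
            using hd_flip_edge_neq[of "xs @ [j]" i] hd j' by auto
          then have 2: "length (flip_edge i (xs @ [j])) = Suc k"
            using True side_depth_flip_edge[of i "xs @ [j]"] j' by (simp add: side_depth_def)
          show ?thesis
            using y'(1)[OF flip_edge_in_verts[OF assms(2) a(1)] 2 1] True hd d j'
            by (simp add: g'_def)
        qed
      qed
    qed
    ultimately show ?case by blast
  qed
  from this[OF order_refl] obtain g where g: "region_hom i r g" "col g = Some i"
    "col (g \<circ> flip_edge i) = Some i"
    unfolding diff_self_eq_0 bob_wins.simps(1) by blast
  have iV: "[i] \<in> V" using assms(2) by (simp add: regular_tree_verts_Cons)
  have nonisol: "\<exists>z. (g xs, z) \<in> E" if "xs \<in> V" "side_depth i xs \<le> r" for xs
  proof (cases xs rule: rev_cases)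
    case Nil
    then show ?thesis using region_homD[OF g(1), of "[]" i] iV by (auto simp: side_depth_def)
  next
    case (snoc zs j)
    have "side_depth i zs \<le> side_depth i xs"
      using snoc by (cases "zs \<noteq> [] \<or> j \<noteq> i") (auto simp: side_depth_snoc, simp add: side_depth_def)
    then have "(g zs, g xs) \<in> E" using region_homD[OF g(1), of zs j] that snoc by simp
    then show ?thesis using sym_E by (auto dest: symD)
  qed
  \<comment> \<open>The extra layer makes \<open>f\<close> a homomorphism on \<open>r + 1\<close>
    levels, as \<open>col_flip\<close> demands. Both outputs depend only on vertices of side depth
    at most \<open>r\<close>, where \<open>f\<close> agrees with \<open>g\<close>.\<close>
  define f where "f xs = (if side_depth i xs = Suc r then SOME z. (g (butlast xs), z) \<in> E else g xs)" for xs
  have "tree_hom_upto \<Delta> E (Suc r) f"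
    unfolding tree_hom_upto_def
  proof (intro allI impI)
    fix xs j assume *: "xs @ [j] \<in> V" "length xs < Suc r"
    then have "side_depth i xs \<le> r" "side_depth i (xs @ [j]) \<le> Suc r" "xs \<in> V"
      using side_depth_le_length[of i xs] side_depth_le_length[of i "xs @ [j]"]
      by (auto simp: regular_tree_verts_snoc)
    then show "(f xs, f (xs @ [j])) \<in> E"
      using region_homD[OF g(1) *(1)] someI_ex[OF nonisol[of xs]]
      by (cases "side_depth i (xs @ [j]) = Suc r") (auto simp: f_def)
  qed
  moreover have f_g: "f xs = g xs" if "side_depth i xs \<le> r" for xs
    using that by (simp add: f_def)
  have "col f = col g"
    by (rule col_cong, rule f_g) (rule order_trans[OF side_depth_le_length])
  moreover have "col (f \<circ> flip_edge i) = col (g \<circ> flip_edge i)"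
    by (rule col_cong, simp, rule f_g, simp) (rule order_trans[OF side_depth_le_length])
  ultimately show False using col_flip[OF assms(2)] g by metis
qed

lemma ex_proper_coloring:
  "\<exists>c. \<forall>(u, v) \<in> E. c u < \<Delta> \<and> c v < \<Delta> \<and> c u \<noteq> c v"
proof -
  \<comment> \<open>A winning colour is known only for labels with a neighbour; the guard allows
    choice over all \<open>u\<close>.\<close>
  have "\<exists>i. (\<exists>v. (u, v) \<in> E) \<longrightarrow> i < \<Delta> \<and> bob_wins i r (\<lambda>_. u)" for u
    using ex_bob_wins by blast
  then obtain c where "\<And>u v. (u, v) \<in> E \<Longrightarrow> c u < \<Delta> \<and> bob_wins (c u) r (\<lambda>_. u)" by metis
  note c = this
  have "c u < \<Delta> \<and> c v < \<Delta> \<and> c u \<noteq> c v" if uv: "(u, v) \<in> E" for u v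
    using c[OF uv] c[OF symD[OF sym_E uv]] adjacent_not_both_bob_wins[OF uv, of "c u"] by auto
  then show ?thesis by blast
qed

end

section \<open>Balls, by recursion on the radius\<close>

lemma ball_verts_0: "ball_verts G v 0 = {v} \<inter> pverts G"
  by (auto simp: ball_verts_def pre_digraph.awalk_def pre_digraph.cas.simps)

lemma ball_verts_Suc:
  assumes "pair_wf_digraph G"
  shows "ball_verts G v (Suc n) = {u. \<exists>w \<in> ball_verts G v n. w = u \<or> (w, u) \<in> parcs G}"
proof -
  interpret pair_wf_digraph G by fact
  show ?thesis
  proof (intro set_eqI iffI)
    fix u assume "u \<in> ball_verts G v (Suc n)"
    then obtain p where p: "awalk v p u" "length p \<le> Suc n" by (auto simp: ball_verts_def)
    show "u \<in> {u. \<exists>w \<in> ball_verts G v n. w = u \<or> (w, u) \<in> parcs G}"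
    proof (cases p rule: rev_cases)
      case Nil
      then have "u \<in> ball_verts G v n"
        using p unfolding ball_verts_def by (intro CollectI exI[of _ "[]"]) simp
      then show ?thesis by blast
    next
      case (snoc q e)
      then have q: "awalk v q (awlast v q)" "awalk (awlast v q) [e] u" using p(1) by auto
      then have "awlast v q \<in> ball_verts G v n" using p(2) snoc by (auto simp: ball_verts_def)
      moreover have "(awlast v q, u) \<in> parcs G"
        using q(2) by (cases e) (auto simp: awalk_simps)
      ultimately show ?thesis by blast
    qed
  next
    fix u assume "u \<in> {u. \<exists>w \<in> ball_verts G v n. w = u \<or> (w, u) \<in> parcs G}"
    then obtain w p where w: "awalk v p w" "length p \<le> n" "w = u \<or> (w, u) \<in> parcs G"
      by (auto simp: ball_verts_def)
    show "u \<in> ball_verts G v (Suc n)"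
    proof (cases "w = u")
      case True
      with w show ?thesis by (auto simp: ball_verts_def)
    next
      case False
      with w(3) have "awalk w [(w, u)] u" by (auto simp: awalk_simps wellformed')
      with w(1) have "awalk v (p @ [(w, u)]) u" by (rule awalk_appendI)
      then show ?thesis using w(2) unfolding ball_verts_def
        by (intro CollectI exI[of _ "p @ [(w, u)]"]) simp
    qed
  qed
qed

lemma ball_verts_Suc_mono:
  "pair_wf_digraph G \<Longrightarrow> ball_verts G v n \<subseteq> ball_verts G v (Suc n)"
  by (auto simp: ball_verts_Suc)

lemma ball_verts_subset: "pair_wf_digraph G \<Longrightarrow> ball_verts G v n \<subseteq> pverts G"
  by (induction n) (auto simp: ball_verts_0 ball_verts_Suc pair_wf_digraph.in_arcsD2)

lemma ball_verts_hom:
  assumes "pair_wf_digraph G" "\<And>u. u \<in> pverts G \<Longrightarrow> f u \<in> pverts G"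
    "\<And>u w. (u, w) \<in> parcs G \<Longrightarrow> (f u, f w) \<in> parcs G"
  shows "u \<in> ball_verts G v n \<Longrightarrow> f u \<in> ball_verts G (f v) n"
proof (induction n arbitrary: u)
  case (Suc n)
  then obtain w where "w \<in> ball_verts G v n" "w = u \<or> (w, u) \<in> parcs G"
    by (auto simp: ball_verts_Suc[OF assms(1)])
  then show ?case unfolding ball_verts_Suc[OF assms(1)] using Suc.IH assms(3) by blast
qed (simp add: ball_verts_0 assms(2))

lemma pair_wf_digraph_graph_ball: "pair_wf_digraph (graph_ball G v n)"
  by unfold_locales (auto simp: graph_ball_def)

text \<open>All smaller balls about \<open>v\<close> also lie in the outer ball, so no intermediate
  vertex is lost. Hence a vertex sees the same in a truncated tree as in
  \<open>regular_tree\<close>, provided its ball survives the truncation.\<close>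

lemma graph_ball_graph_ball:
  assumes "pair_wf_digraph G" "ball_verts G v n \<subseteq> ball_verts G w m"
  shows "graph_ball (graph_ball G w m) v n = graph_ball G v n"
proof -
  have "ball_verts (graph_ball G w m) v k = ball_verts G v k"
    if "ball_verts G v k \<subseteq> ball_verts G w m" for k
    using that
  proof (induction k)
    case 0
    then show ?case
      using ball_verts_subset[OF assms(1)] by (auto simp: ball_verts_0 graph_ball_def)
  next
    case (Suc k)
    then have k: "ball_verts G v k \<subseteq> ball_verts G w m"
      using ball_verts_Suc_mono[OF assms(1)] by blast
    show ?case
      using Suc.prems k
      unfolding ball_verts_Suc[OF pair_wf_digraph_graph_ball] ball_verts_Suc[OF assms(1)] Suc.IH[OF k]
      by (auto simp: graph_ball_def)
  qed
  from this[OF assms(2)] assms(2) show ?thesis by (auto simp: graph_ball_def)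
qed

lemma pair_wf_regular_tree: "pair_wf_digraph (regular_tree \<Delta>)"
  using regular_tree_bidirected
  by (simp add: pair_bidirected_digraph_def pair_sym_digraph_def)

lemma ball_verts_regular_tree_root:
  "ball_verts (regular_tree \<Delta>) [] n = {xs \<in> regular_tree_verts \<Delta>. length xs \<le> n}"
proof (induction n)
  case 0
  then show ?case by (auto simp: ball_verts_0 regular_tree_verts_Nil)
next
  case (Suc n)
  have *: "\<exists>w \<in> regular_tree_verts \<Delta>. length w \<le> n \<and> (w = xs \<or> (w, xs) \<in> parcs (regular_tree \<Delta>))"
    if "xs \<in> regular_tree_verts \<Delta>" "length xs \<le> Suc n" for xs
  proof (cases xs rule: rev_cases)
    case (snoc ys j)
    with that have "ys \<in> regular_tree_verts \<Delta>" by (simp add: regular_tree_verts_snoc)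
    with that snoc show ?thesis by (intro bexI[of _ ys]) (auto simp: in_parcs_regular_tree)
  qed (use that in force)
  show ?case
    unfolding ball_verts_Suc[OF pair_wf_regular_tree] Suc.IH
    using * by (auto simp: in_parcs_regular_tree)
qed

lemma ball_verts_flip_edge:
  assumes "i < \<Delta>"
  shows "ball_verts (regular_tree \<Delta>) (flip_edge i v) n = flip_edge i ` ball_verts (regular_tree \<Delta>) v n"
proof -
  have *: "flip_edge i u \<in> ball_verts (regular_tree \<Delta>) (flip_edge i w) n"
    if "u \<in> ball_verts (regular_tree \<Delta>) w n" for u w
    using that by (rule ball_verts_hom[OF pair_wf_regular_tree, rotated -1])
      (auto simp: flip_edge_in_verts flip_edge_arc assms)
  show ?thesis using *[of _ v] *[of _ "flip_edge i v"] by (force simp: image_iff)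
qed

section \<open>Isomorphism classes of views\<close>

lemma rooted_labeled_iso_sym:
  assumes "(S, T) \<in> rooted_labeled_iso" "pair_wf_digraph (skel S)" "root S \<in> pverts (skel S)"
  shows "(T, S) \<in> rooted_labeled_iso"
proof -
  interpret pair_wf_digraph "skel S" by fact
  obtain f where f: "bij_betw f (pverts (skel S)) (pverts (skel T))"
    "parcs (skel T) = map_prod f f ` parcs (skel S)" "f (root S) = root T"
    "\<And>v. v \<in> pverts (skel S) \<Longrightarrow> lab T (f v) = lab S v"
    using assms(1) by (auto simp: rooted_labeled_iso_def)
  \<comment> \<open>This inverse is controlled only on the vertices of \<open>S\<close>, so the arcs
    and the root of \<open>S\<close> must lie among them.\<close>
  let ?g = "the_inv_into (pverts (skel S)) f"
  have inv: "?g (f v) = v" if "v \<in> pverts (skel S)" for v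
    using that f(1) by (simp add: bij_betw_def the_inv_into_f_f)
  have "map_prod ?g ?g ` parcs (skel T) = (\<lambda>e. e) ` parcs (skel S)"
    unfolding f(2) image_image
    by (rule image_cong) (auto simp: inv in_arcsD1 in_arcsD2)
  moreover have "bij_betw ?g (pverts (skel T)) (pverts (skel S))"
    using f(1) by (rule bij_betw_the_inv_into)
  moreover have "?g (root T) = root S" using inv[OF assms(3)] f(3) by simp
  moreover have "lab S (?g v) = lab T v" if "v \<in> pverts (skel T)" for v
  proof -
    from that f(1) obtain u where "u \<in> pverts (skel S)" "v = f u" by (auto simp: bij_betw_def)
    then show ?thesis using f(4) inv by simp
  qed
  ultimately show ?thesis unfolding rooted_labeled_iso_def by auto
qed

lemma rooted_labeled_iso_trans:
  assumes "(S, T) \<in> rooted_labeled_iso" "(T, U) \<in> rooted_labeled_iso"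
  shows "(S, U) \<in> rooted_labeled_iso"
proof -
  obtain f where f: "bij_betw f (pverts (skel S)) (pverts (skel T))"
    "parcs (skel T) = map_prod f f ` parcs (skel S)" "f (root S) = root T"
    "\<And>v. v \<in> pverts (skel S) \<Longrightarrow> lab T (f v) = lab S v"
    using assms(1) by (auto simp: rooted_labeled_iso_def)
  obtain g where g: "bij_betw g (pverts (skel T)) (pverts (skel U))"
    "parcs (skel U) = map_prod g g ` parcs (skel T)" "g (root T) = root U"
    "\<And>v. v \<in> pverts (skel T) \<Longrightarrow> lab U (g v) = lab T v"
    using assms(2) by (auto simp: rooted_labeled_iso_def)
  have "bij_betw (g \<circ> f) (pverts (skel S)) (pverts (skel U))"
    using f(1) g(1) by (rule bij_betw_trans)
  moreover have "parcs (skel U) = map_prod (g \<circ> f) (g \<circ> f) ` parcs (skel S)"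
    by (simp add: f(2) g(2) image_image map_prod.compositionality)
  moreover have "lab U (g (f v)) = lab S v" if "v \<in> pverts (skel S)" for v
    using f(4)[OF that] g(4)[OF bij_betwE[OF f(1), rule_format, OF that]] by simp
  ultimately show ?thesis unfolding rooted_labeled_iso_def using f(3) g(3)
    by (intro CollectI case_prodI exI[of _ "g \<circ> f"]) simp
qed

lemma rooted_labeled_iso_class_eq:
  assumes "(S, T) \<in> rooted_labeled_iso" "pair_wf_digraph (skel S)" "root S \<in> pverts (skel S)"
  shows "rooted_labeled_iso `` {S} = rooted_labeled_iso `` {T}"
  using rooted_labeled_iso_sym[OF assms] assms(1) by (auto intro: rooted_labeled_iso_trans)

lemma rooted_labeled_iso_refl: "(S, S) \<in> rooted_labeled_iso"
  unfolding rooted_labeled_iso_def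
  by (intro CollectI case_prodI exI[of _ id]) (auto simp: map_prod.id)

definition root_view :: "nat \<Rightarrow> nat \<Rightarrow> (nat list \<Rightarrow> 'h) \<Rightarrow> (nat list, 'h) rooted_labeled_graph" where
  "root_view \<Delta> r f = \<lparr> skel = graph_ball (regular_tree \<Delta>) [] r, lab = f, root = [] \<rparr>"

lemma root_view_class_eqI:
  assumes "(root_view \<Delta> r f, T) \<in> rooted_labeled_iso"
  shows "rooted_labeled_iso `` {root_view \<Delta> r f} = rooted_labeled_iso `` {T}"
proof (rule rooted_labeled_iso_class_eq[OF assms])
  show "pair_wf_digraph (skel (root_view \<Delta> r f))"
    by (simp add: root_view_def pair_wf_digraph_graph_ball)
qed (simp add: root_view_def graph_ball_def ball_verts_regular_tree_root regular_tree_verts_Nil)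

lemma root_view_cong:
  assumes "\<And>xs. xs \<in> regular_tree_verts \<Delta> \<Longrightarrow> length xs \<le> r \<Longrightarrow> f xs = g xs"
  shows "rooted_labeled_iso `` {root_view \<Delta> r f} = rooted_labeled_iso `` {root_view \<Delta> r g}"
proof (rule root_view_class_eqI)
  show "(root_view \<Delta> r f, root_view \<Delta> r g) \<in> rooted_labeled_iso"
    unfolding rooted_labeled_iso_def
    by (intro CollectI case_prodI exI[of _ id])
      (auto simp: assms root_view_def graph_ball_def ball_verts_regular_tree_root map_prod.id)
qed

text \<open>\<open>flip_edge i\<close> itself is the isomorphism. The output at \<open>[i]\<close>
  thereby becomes an output at the root, the form that \<open>col_flip\<close> speaks of.\<close>

lemma root_view_flip_edge:
  assumes "i < \<Delta>"
  shows "rooted_labeled_iso `` {root_view \<Delta> r (f \<circ> flip_edge i)} =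
    rooted_labeled_iso `` {\<lparr> skel = graph_ball (regular_tree \<Delta>) [i] r, lab = f, root = [i] \<rparr>}"
proof (rule root_view_class_eqI)
  have b: "ball_verts (regular_tree \<Delta>) [i] r = flip_edge i ` ball_verts (regular_tree \<Delta>) [] r"
    using ball_verts_flip_edge[OF assms, of "[]"] by simp
  have inj: "inj (flip_edge i)" by (metis flip_edge_flip_edge injI)
  have "Restr (parcs (regular_tree \<Delta>)) (flip_edge i ` B) =
      map_prod (flip_edge i) (flip_edge i) ` Restr (parcs (regular_tree \<Delta>)) B" for B
  proof (intro set_eqI iffI)
    fix e assume "e \<in> Restr (parcs (regular_tree \<Delta>)) (flip_edge i ` B)"
    then obtain x y where "e = (flip_edge i x, flip_edge i y)" "x \<in> B" "y \<in> B"
      "(flip_edge i x, flip_edge i y) \<in> parcs (regular_tree \<Delta>)" by auto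
    moreover from flip_edge_arc[OF assms this(4)] have "(x, y) \<in> parcs (regular_tree \<Delta>)" by simp
    ultimately show "e \<in> map_prod (flip_edge i) (flip_edge i) ` Restr (parcs (regular_tree \<Delta>)) B"
      by force
  qed (auto intro: flip_edge_arc assms)
  then show "(root_view \<Delta> r (f \<circ> flip_edge i), \<lparr> skel = graph_ball (regular_tree \<Delta>) [i] r, lab = f, root = [i] \<rparr>)
      \<in> rooted_labeled_iso"
    unfolding rooted_labeled_iso_def root_view_def graph_ball_def b
    by (intro CollectI case_prodI exI[of _ "flip_edge i"])
      (simp add: inj_on_imp_bij_betw inj_on_subset[OF inj])
qed

section \<open>The implications between colourings and algorithms\<close>

lemma ex_coloring_imp_zero_round:
  assumes "proper_coloring H \<Delta> c"
  shows "\<exists>A. glocal_algorithm \<Delta> 0 A \<and> glocal_colors \<Delta> 0 A (Hom_ball \<Delta> r H)"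
proof -
  \<comment> \<open>An algorithm receives a class, so a representative is chosen; isomorphic trees
    have the same root label.\<close>
  define rep :: "(nat list, 'a) rooted_labeled_graph set \<Rightarrow> (nat list, 'a) rooted_labeled_graph" where
    "rep C = (SOME T. C = rooted_labeled_iso `` {T})" for C
  define A where "A C = (if C \<in> rooted_labeled_trees \<Delta> 0 // rooted_labeled_iso
    then Some (c (lab (rep C) (root (rep C)))) else None)" for C
  have "glocal_algorithm \<Delta> 0 A"
    by (auto simp: glocal_algorithm_def A_def split: if_splits)
  \<comment> \<open>At radius 0 the view is a single vertex; without a loop it is a tree, so its
    class is in the domain of \<open>A\<close>.\<close>
  moreover have "run_glocal 0 A G v = Some (c (lab G v))"
    if v: "v \<in> pverts (skel G)" and wf: "pair_wf_digraph (skel G)" and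
      loop: "(v, v) \<notin> parcs (skel G)" for G v
  proof -
    define T where "T = rooted_ball G v 0"
    have sk: "skel T = \<lparr> pverts = {v}, parcs = {} \<rparr>" and rt: "root T = v" "lab T = lab G"
      using v loop by (auto simp: T_def rooted_ball_def graph_ball_def ball_verts_0)
    have pg: "pair_graph (skel T)"
      by unfold_locales (auto simp: sk symmetric_def sym_def)
    interpret pair_graph "skel T" by fact
    have "mk_symmetric (with_proj (skel T)) = skel T" by (simp add: mk_symmetric_def sk)
    moreover have "reachable (with_proj (skel T)) v v" by (rule reachable_refl) (simp add: sk)
    then have "strongly_connected (with_proj (skel T))"
      by (intro strongly_connectedI) (simp_all add: sk)
    ultimately have "Digraph_Component.connected (with_proj (skel T))"
      by (simp add: Digraph_Component.connected_def)
    moreover have "\<not> (\<exists>p. cycle p \<and> 3 \<le> length p)"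
      using arg_cong[OF sk, of parcs] by (auto simp: cycle_def awalk_def)
    moreover have "pair_bidirected_digraph (skel T)" by unfold_locales
    ultimately have "undirected_tree (skel T)" by (simp add: undirected_tree_def)
    then have "T \<in> rooted_labeled_trees \<Delta> 0"
      using pg by (auto simp: rooted_labeled_trees_def sk rt ball_verts_0 out_degree_def out_arcs_def)
    then have C: "rooted_labeled_iso `` {T} \<in> rooted_labeled_trees \<Delta> 0 // rooted_labeled_iso"
      by (rule quotientI)
    define R where "R = rep (rooted_labeled_iso `` {T})"
    have "rooted_labeled_iso `` {T} = rooted_labeled_iso `` {R}"
      unfolding R_def rep_def by (rule someI) (rule refl)
    then have "(T, R) \<in> rooted_labeled_iso" using rooted_labeled_iso_refl[of R] by blast
    then have "lab R (root R) = lab G v"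
      by (auto simp: rooted_labeled_iso_def sk rt)
    then show ?thesis using C by (simp add: run_glocal_def A_def T_def R_def)
  qed
  moreover have "proper_coloring (skel G) \<Delta> (c \<circ> lab G) \<and> pair_wf_digraph (skel G) \<and>
      (\<forall>v. (v, v) \<notin> parcs (skel G))" if G: "G \<in> Hom_ball \<Delta> r H" for G
  proof -
    obtain f where f: "skel G = graph_ball (regular_tree \<Delta>) [] r" "lab G = f"
        "graph_hom (graph_ball (regular_tree \<Delta>) [] r) H f"
      using G by (auto simp: Hom_ball_def)
    have "(v, v) \<notin> parcs (skel G)" for v by (auto simp: f(1) graph_ball_def in_parcs_regular_tree)
    moreover have "proper_coloring (skel G) \<Delta> (c \<circ> lab G)"
      using assms f by (fastforce simp: proper_coloring_def graph_hom_def)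
    ultimately show ?thesis using f(1) by (simp add: pair_wf_digraph_graph_ball)
  qed
  ultimately show ?thesis
    unfolding glocal_colors_def by (intro exI[of _ A] conjI ballI exI[of _ "c \<circ> lab _"]) auto
qed

lemma glocal_imp_ex_coloring:
  assumes "pair_graph H" "\<Delta> > 0" "glocal_colors \<Delta> r A (Hom_ball \<Delta> (r + 1) H)"
  shows "\<exists>c. proper_coloring H \<Delta> c"
proof -
  interpret pair_graph H by fact
  define col where "col f = A (rooted_labeled_iso `` {root_view \<Delta> r f})" for f
  let ?T = "regular_tree \<Delta>"
  \<comment> \<open>This collects what \<open>root_coloring\<close> asks of \<open>col\<close>, from
    the colouring at the root and its neighbours.\<close>
  have hom: "\<exists>c. c [] < \<Delta> \<and> col f = Some (c []) \<and>
      (\<forall>i < \<Delta>. c [] \<noteq> c [i] \<and> col (f \<circ> flip_edge i) = Some (c [i]))"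
    if f: "tree_hom_upto \<Delta> (parcs H) (Suc r) f" for f
  proof -
    define G where "G = \<lparr> skel = graph_ball ?T [] (r + 1), lab = f \<rparr>"
    have arc: "(f xs, f ys) \<in> parcs H" if "(xs, ys) \<in> parcs (skel G)" for xs ys
      using that f arcs_symmetric
      by (auto simp: G_def graph_ball_def ball_verts_regular_tree_root tree_hom_upto_def in_parcs_regular_tree)
    have "f xs \<in> pverts H" if "xs \<in> pverts (skel G)" for xs
    proof (cases xs rule: rev_cases)
      case Nil
      have "([], [0]) \<in> parcs (skel G)" using assms(2)
        by (auto simp: G_def graph_ball_def ball_verts_regular_tree_root in_parcs_regular_tree
            regular_tree_verts_Cons regular_tree_verts_Nil)
      then show ?thesis using Nil arc in_arcsD1 by blast
    next
      case (snoc ys j)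
      with that have "(ys, xs) \<in> parcs (skel G)"
        by (auto simp: G_def graph_ball_def ball_verts_regular_tree_root in_parcs_regular_tree
            regular_tree_verts_snoc)
      then show ?thesis using arc in_arcsD2 by blast
    qed
    with arc have "graph_hom (graph_ball ?T [] (r + 1)) H f"
      by (auto simp: graph_hom_def G_def)
    then have "G \<in> Hom_ball \<Delta> (r + 1) H" by (auto simp: G_def Hom_ball_def)
    then obtain c where c: "proper_coloring (skel G) \<Delta> c"
      "\<And>v. v \<in> pverts (skel G) \<Longrightarrow> run_glocal r A G v = Some (c v)"
      using assms(3) unfolding glocal_colors_def by blast
    have root: "[] \<in> pverts (skel G)"
      by (simp add: G_def graph_ball_def ball_verts_regular_tree_root regular_tree_verts_Nil)
    have "run_glocal r A G [] = col f"
      by (simp add: run_glocal_def rooted_ball_def G_def col_def root_view_def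
          graph_ball_graph_ball pair_wf_regular_tree ball_verts_Suc_mono)
    moreover have "c [] \<noteq> c [i] \<and> col (f \<circ> flip_edge i) = Some (c [i])" if i: "i < \<Delta>" for i
    proof -
      \<comment> \<open>Here the radius \<open>r + 1\<close> matters: the neighbours of the root
        still see their full ball of radius \<open>r\<close>.\<close>
      have "ball_verts ?T [i] r \<subseteq> ball_verts ?T [] (r + 1)"
      proof
        fix u assume "u \<in> ball_verts ?T [i] r"
        then obtain w where w: "w \<in> regular_tree_verts \<Delta>" "length w \<le> r" "u = flip_edge i w"
          using ball_verts_flip_edge[OF i, of "[]"] by (auto simp: ball_verts_regular_tree_root)
        have "length (flip_edge i w) \<le> Suc (length w)"
          by (cases w) (auto split: list.splits)
        then show "u \<in> ball_verts ?T [] (r + 1)"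
          using w by (simp add: ball_verts_regular_tree_root flip_edge_in_verts i)
      qed
      then have "run_glocal r A G [i] = col (f \<circ> flip_edge i)"
        by (simp add: run_glocal_def rooted_ball_def G_def col_def root_view_flip_edge[OF i]
          graph_ball_graph_ball pair_wf_regular_tree)
      moreover have "([], [i]) \<in> parcs (skel G)" "[i] \<in> pverts (skel G)" using i
        by (auto simp: G_def graph_ball_def ball_verts_regular_tree_root in_parcs_regular_tree
            regular_tree_verts_Cons regular_tree_verts_Nil)
      ultimately show ?thesis using c by (fastforce simp: proper_coloring_def)
    qed
    ultimately show ?thesis using c root by (intro exI[of _ c]) (auto simp: proper_coloring_def)
  qed
  interpret root_coloring \<Delta> r "parcs H" col
  proof
    show "sym (parcs H)" using pair_sym_arcs by (simp add: symmetric_def)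
    show "col f = col g" if "\<And>xs. xs \<in> regular_tree_verts \<Delta> \<Longrightarrow> length xs \<le> r \<Longrightarrow> f xs = g xs" for f g
      using root_view_cong[of \<Delta> r f g] that by (simp add: col_def)
    show "\<exists>c < \<Delta>. col f = Some c" if "tree_hom_upto \<Delta> (parcs H) (Suc r) f" for f
      using hom[OF that] by blast
    show "col f \<noteq> col (f \<circ> flip_edge i)" if "i < \<Delta>" "tree_hom_upto \<Delta> (parcs H) (Suc r) f" for f i
      using hom[OF that(2)] that(1) by force
  qed
  obtain c where c: "\<forall>(u, v) \<in> parcs H. c u < \<Delta> \<and> c v < \<Delta> \<and> c u \<noteq> c v"
    using ex_proper_coloring by blast
  \<comment> \<open>Vertices on no arc may need the default 0, a valid colour as
    \<open>\<Delta> > 0\<close>; ends of arcs keep their colour.\<close>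
  have "proper_coloring H \<Delta> (\<lambda>v. if c v < \<Delta> then c v else 0)"
    using c assms(2) by (fastforce simp: proper_coloring_def)
  then show ?thesis by blast
qed

theorem mainTheorem4:
  fixes H :: "'h pair_pre_digraph" and \<Delta> :: nat
  assumes "pair_graph H" and "\<Delta> > 0"
  shows "((\<exists>c. proper_coloring H \<Delta> c) \<longleftrightarrow>
           (\<forall>r. \<exists>A. glocal_algorithm \<Delta> 0 A \<and> glocal_colors \<Delta> 0 A (Hom_ball \<Delta> r H))) \<and>
         ((\<forall>r. \<exists>A. glocal_algorithm \<Delta> 0 A \<and> glocal_colors \<Delta> 0 A (Hom_ball \<Delta> r H)) \<longleftrightarrow>
           (\<exists>r A. glocal_algorithm \<Delta> r A \<and> glocal_colors \<Delta> r A (Hom_ball \<Delta> (r + 1) H)))"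
  \<comment> \<open>(2) at radius 1 is an instance of (3) with \<open>r = 0\<close>.\<close>
  using ex_coloring_imp_zero_round glocal_imp_ex_coloring[OF assms] by blast

end
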